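(* Let $\phi(t)=\mathbf{E}e^{itY}$ be the characteristic function of the limiting Quicksort random variable $Y$ (which is infinitely differentiable). For each real $p\ge0$ and integer $k\ge0$ there is a constant $c_{p,k}$ such that $|\phi^{(k)}(t)|\le c_{p,k}|t|^{-p}$ for all $t\in\mathbb{R}$.
   Context: Let $g(u):=2u\ln u+2(1-u)\ln(1-u)+1$ for $u\in(0,1)$. The limiting Quicksort random variable $Y$ is the limit in distribution of $(X_n-\mathbf{E}X_n)/n$, where $X_n$ is the number of comparisons used by randomized Quicksort on $n$ distinct numbers; equivalently, its law is the unique law with $\mathbf{E}Y=0$ and finite variance satisfying $Y\overset{d}{=}UY+(1-U)Z+g(U)$, where on the right $U,Y,Z$ are independent, $Z\overset{d}{=}Y$ and $U$ is uniform on $(0,1)$. $Y$ has finite moments of all orders. *)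

theory Defs
  imports "HOL-Probability.Probability"
begin

definition quicksort_g :: "real \<Rightarrow> real" where
  "quicksort_g u = 2 * u * ln u + 2 * (1 - u) * ln (1 - u) + 1"

text \<open>The law of the limiting Quicksort random variable Y: a probability law on the
  reals with mean 0, finite variance, and Y =d U Y + (1-U) Z + g(U) with U uniform on (0,1),
  U, Y, Z independent and Z =d Y.  (Such a law is unique.)\<close>
definition quicksort_limit_law :: "real measure \<Rightarrow> bool" where
  "quicksort_limit_law \<mu> \<longleftrightarrow>
     real_distribution \<mu> \<and>
     integrable \<mu> (\<lambda>x. x) \<and> (\<integral>x. x \<partial>\<mu>) = 0 \<and>
     integrable \<mu> (\<lambda>x. x ^ 2) \<and>
     distr (uniform_measure lborel {0<..<1} \<Otimes>\<^sub>M (\<mu> \<Otimes>\<^sub>M \<mu>)) borel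
       (\<lambda>(u, y, z). u * y + (1 - u) * z + quicksort_g u) = \<mu>"

definition nth_deriv :: "nat \<Rightarrow> (real \<Rightarrow> complex) \<Rightarrow> real \<Rightarrow> complex" where
  "nth_deriv k f = ((\<lambda>h t. vector_derivative h (at t)) ^^ k) f"

end

theory Submission
  imports Defs
begin

text \<open>
  All moments of \<open>Y\<close> are finite: if those of order at most \<open>n + 1\<close> are, then the truncation
  \<open>F x = x\<^sup>2 * min \<bar>x\<bar> M ^ n\<close> of \<open>\<bar>x\<bar> ^ (n + 2)\<close> satisfies
  \<open>F (u * x) \<le> u\<^sup>2 * F x\<close> and is additive up to products of lower powers, so the distributional
  identity gives \<open>E F(Y) \<le> 2/3 * E F(Y) + K\<close> with \<open>K\<close> independent of \<open>M\<close>. Hence the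
  characteristic function is smooth with bounded derivatives.

  Given \<open>Y = y\<close> and \<open>Z = z\<close>, the phase \<open>u * y + (1 - u) * z + g u\<close> has second derivative at
  least 2 in \<open>u\<close>, uniformly in \<open>y\<close> and \<open>z\<close>, so van der Corput's lemma yields
  \<open>\<bar>\<phi> t\<bar> \<le> 8 / sqrt \<bar>t\<bar>\<close>. Since \<open>\<bar>\<phi> t\<bar>\<close> is at most the integral of
  \<open>\<bar>\<phi> (t * u)\<bar> * \<bar>\<phi> (t * (1 - u))\<bar>\<close> over the unit interval, using the bound already known on
  the factor with the larger argument and this first bound on the other one gains a factor
  \<open>1 / sqrt \<bar>t\<bar>\<close>, and can be repeated indefinitely. Landau's inequality
  transfers the decay to the derivatives.
\<close>

section \<open>Oscillatory integrals\<close>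

text \<open>Integration by parts: \<open>F\<close> has derivative \<open>iexp (t * h x)\<close> up
  to an error of norm \<open>h'' x / (\<bar>t\<bar> * (h' x)\<^sup>2)\<close>. Since
  \<open>h''\<close> is nonnegative, this norm is itself the derivative of \<open>G\<close>, so the
  error integrates to at most \<open>G b - G a\<close>. What remains are four boundary values, two
  of \<open>F\<close> and two of \<open>G\<close>, each at most
  \<open>1 / (l * \<bar>t\<bar>)\<close>.\<close>

lemma oscillatory_integral_first_derivative:
  fixes h h' h'' :: "real \<Rightarrow> real"
  assumes "a \<le> b" "t \<noteq> 0" "0 < l"
    and h: "\<And>x. x \<in> {a..b} \<Longrightarrow> (h has_real_derivative h' x) (at x)"
    and h': "\<And>x. x \<in> {a..b} \<Longrightarrow> (h' has_real_derivative h'' x) (at x)"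
    and nonneg: "\<And>x. x \<in> {a..b} \<Longrightarrow> 0 \<le> h'' x"
    and l: "\<And>x. x \<in> {a..b} \<Longrightarrow> l \<le> \<bar>h' x\<bar>"
  shows "norm (integral {a..b} (\<lambda>x. iexp (t * h x))) \<le> 4 / (l * \<bar>t\<bar>)"
proof -
  have nz: "h' x \<noteq> 0" if "x \<in> {a..b}" for x
    using l[OF that] \<open>0 < l\<close> by auto
  define F where "F x = (1 / (\<i> * t)) * (iexp (t * h x) * complex_of_real (1 / h' x))" for x
  define F' where "F' x = iexp (t * h x) - iexp (t * h x) * complex_of_real (h'' x / (h' x)\<^sup>2) / (\<i> * t)" for x
  define G where "G x = - (1 / \<bar>t\<bar>) * (1 / h' x)" for x
  have dinv: "((\<lambda>x. 1 / h' x) has_real_derivative (- h'' x / (h' x)\<^sup>2)) (at x)" if x: "x \<in> {a..b}" for x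
    using h'[OF x] nz[OF x] by (auto intro!: derivative_eq_intros simp: power2_eq_square)
  have dF: "(F has_vector_derivative F' x) (at x within {a..b})" if x: "x \<in> {a..b}" for x
  proof -
    have "((\<lambda>x. t * h x) has_vector_derivative t * h' x) (at x)"
      using DERIV_cmult[OF h[OF x], of t] by (simp add: has_real_derivative_iff_has_vector_derivative)
    from vector_diff_chain_at[OF this has_vector_derivative_iexp]
    have e: "((\<lambda>x. iexp (t * h x)) has_vector_derivative (t * h' x) *\<^sub>R (\<i> * iexp (t * h x))) (at x within {a..b})"
      by (auto simp: o_def intro: has_vector_derivative_at_within)
    have i: "((\<lambda>x. complex_of_real (1 / h' x)) has_vector_derivative complex_of_real (- h'' x / (h' x)\<^sup>2)) (at x within {a..b})"
      using dinv[OF x] by (intro has_vector_derivative_of_real has_vector_derivative_at_within)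
        (simp add: has_real_derivative_iff_has_vector_derivative)
    have "(F has_vector_derivative
       (1 / (\<i> * t)) * (iexp (t * h x) * complex_of_real (- h'' x / (h' x)\<^sup>2)
         + ((t * h' x) *\<^sub>R (\<i> * iexp (t * h x))) * complex_of_real (1 / h' x))) (at x within {a..b})"
      unfolding F_def by (intro has_vector_derivative_mult_right has_vector_derivative_mult e i)
    moreover have "(1 / (\<i> * t)) * (iexp (t * h x) * complex_of_real (- h'' x / (h' x)\<^sup>2)
         + ((t * h' x) *\<^sub>R (\<i> * iexp (t * h x))) * complex_of_real (1 / h' x)) = F' x"
      using nz[OF x] \<open>t \<noteq> 0\<close> by (simp add: F'_def scaleR_conv_of_real field_simps)
    ultimately show ?thesis by simp
  qed
  have dG: "(G has_vector_derivative h'' x / (\<bar>t\<bar> * (h' x)\<^sup>2)) (at x within {a..b})" if x: "x \<in> {a..b}" for x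
  proof -
    have "(G has_real_derivative (- (1 / \<bar>t\<bar>)) * (- h'' x / (h' x)\<^sup>2)) (at x)"
      unfolding G_def by (rule DERIV_cmult[OF dinv[OF x]])
    moreover have "(- (1 / \<bar>t\<bar>)) * (- h'' x / (h' x)\<^sup>2) = h'' x / (\<bar>t\<bar> * (h' x)\<^sup>2)"
      by simp
    ultimately show ?thesis
      unfolding has_real_derivative_iff_has_vector_derivative
      by (simp only: has_vector_derivative_at_within)
  qed
  have cont: "continuous_on {a..b} h"
    using h by (meson DERIV_isCont continuous_at_imp_continuous_on)
  have int: "(\<lambda>x. iexp (t * h x)) integrable_on {a..b}"
    by (intro integrable_continuous_real continuous_intros cont)
  have FI: "(F' has_integral F b - F a) {a..b}"
    using \<open>a \<le> b\<close> dF by (intro fundamental_theorem_of_calculus)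
  have GI: "((\<lambda>x. h'' x / (\<bar>t\<bar> * (h' x)\<^sup>2)) has_integral G b - G a) {a..b}"
    using \<open>a \<le> b\<close> dG by (intro fundamental_theorem_of_calculus)
  have DI: "((\<lambda>x. iexp (t * h x) - F' x) has_integral integral {a..b} (\<lambda>x. iexp (t * h x)) - (F b - F a)) {a..b}"
    by (intro has_integral_diff integrable_integral int FI)
  have "norm (integral {a..b} (\<lambda>x. iexp (t * h x)) - (F b - F a)) \<le> G b - G a"
  proof -
    have "norm (integral {a..b} (\<lambda>x. iexp (t * h x) - F' x)) \<le> integral {a..b} (\<lambda>x. h'' x / (\<bar>t\<bar> * (h' x)\<^sup>2))"
      using DI GI nonneg
      by (intro Henstock_Kurzweil_Integration.integral_norm_bound_integral)
        (auto simp: F'_def norm_mult norm_divide abs_mult mult.commute simp flip: of_real_power)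
    then show ?thesis using DI GI by (simp add: integral_unique)
  qed
  moreover have "norm (F x) \<le> 1 / (l * \<bar>t\<bar>)" "\<bar>G x\<bar> \<le> 1 / (l * \<bar>t\<bar>)" if "x \<in> {a..b}" for x
  proof -
    have "1 / (\<bar>h' x\<bar> * \<bar>t\<bar>) \<le> 1 / (l * \<bar>t\<bar>)"
      using l[OF that] \<open>0 < l\<close> \<open>t \<noteq> 0\<close> by (intro divide_left_mono mult_right_mono mult_pos_pos) auto
    moreover have "norm (F x) = 1 / (\<bar>h' x\<bar> * \<bar>t\<bar>)" "\<bar>G x\<bar> = 1 / (\<bar>h' x\<bar> * \<bar>t\<bar>)"
      by (simp_all add: F_def G_def norm_mult norm_divide abs_mult mult.commute)
    ultimately show "norm (F x) \<le> 1 / (l * \<bar>t\<bar>)" "\<bar>G x\<bar> \<le> 1 / (l * \<bar>t\<bar>)" by simp_all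
  qed
  from this[of a] this[of b] have "norm (F a) \<le> 1 / (l * \<bar>t\<bar>)" "norm (F b) \<le> 1 / (l * \<bar>t\<bar>)"
     "\<bar>G a\<bar> \<le> 1 / (l * \<bar>t\<bar>)" "\<bar>G b\<bar> \<le> 1 / (l * \<bar>t\<bar>)" using \<open>a \<le> b\<close> by auto
  moreover have "norm (integral {a..b} (\<lambda>x. iexp (t * h x))) \<le>
      norm (integral {a..b} (\<lambda>x. iexp (t * h x)) - (F b - F a)) + (norm (F b) + norm (F a))"
    using norm_triangle_ineq[of "integral {a..b} (\<lambda>x. iexp (t * h x)) - (F b - F a)" "F b - F a"]
      norm_triangle_ineq4[of "F b" "F a"] by simp
  ultimately show ?thesis by simp
qed

text \<open>The second-derivative test of van der Corput: \<open>h'\<close> has at most one zero, and outside a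
  \<open>\<delta>\<close>-neighbourhood of it the first-derivative test applies.\<close>

lemma oscillatory_integral_second_derivative:
  fixes h h' h'' :: "real \<Rightarrow> real"
  assumes "a \<le> b" "t \<noteq> 0" "0 < r" "0 < \<delta>"
    and h: "\<And>x. x \<in> {a..b} \<Longrightarrow> (h has_real_derivative h' x) (at x)"
    and h': "\<And>x. x \<in> {a..b} \<Longrightarrow> (h' has_real_derivative h'' x) (at x)"
    and r: "\<And>x. x \<in> {a..b} \<Longrightarrow> r \<le> h'' x"
  shows "norm (integral {a..b} (\<lambda>x. iexp (t * h x))) \<le> 2 * \<delta> + 8 / (r * \<delta> * \<bar>t\<bar>)"
proof -
  let ?I = "\<lambda>c d. integral {c..d} (\<lambda>x. iexp (t * h x))"
  have int: "(\<lambda>x. iexp (t * h x)) integrable_on {c..d}" if "a \<le> c" "d \<le> b" for c d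
  proof -
    have "continuous_on {c..d} h"
      using h that by (meson DERIV_isCont atLeastAtMost_iff continuous_at_imp_continuous_on order_trans)
    then show ?thesis by (intro integrable_continuous_real continuous_intros)
  qed
  have growth: "r * (y - x) \<le> h' y - h' x" if "a \<le> x" "x \<le> y" "y \<le> b" for x y
  proof -
    have "h' x - r * x \<le> h' y - r * y"
      using that r
      by (intro DERIV_nonneg_imp_nondecreasing[where f = "\<lambda>x. h' x - r * x"])
        (auto intro!: derivative_eq_intros h' exI)
    then show ?thesis by (simp add: algebra_simps)
  qed
  have short: "norm (?I c d) \<le> \<delta>" if "a \<le> c" "d \<le> b" "d - c \<le> \<delta>" for c d
  proof (cases "c \<le> d")
    case True
    have "norm (?I c d) \<le> integral {c..d} (\<lambda>x. 1)"
      using that by (intro Henstock_Kurzweil_Integration.integral_norm_bound_integral int) auto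
    then show ?thesis using True that by simp
  qed (use \<open>0 < \<delta>\<close> in auto)
  have long: "norm (?I c d) \<le> 4 / (r * \<delta> * \<bar>t\<bar>)"
    if "a \<le> c" "d \<le> b" "c \<le> d" "\<And>x. x \<in> {c..d} \<Longrightarrow> r * \<delta> \<le> \<bar>h' x\<bar>" for c d
    using that h h' r \<open>t \<noteq> 0\<close> \<open>0 < r\<close> \<open>0 < \<delta>\<close> order_trans[OF less_imp_le[OF \<open>0 < r\<close>] r]
    by (intro oscillatory_integral_first_derivative[of _ _ _ _ h h' h'']) auto
  \<comment> \<open>To the right of a point where \<open>h'\<close> is nonnegative, the lower bound
    on \<open>h''\<close> makes \<open>h'\<close> at least \<open>r * \<delta>\<close> after a
    distance \<delta>. The first stretch is estimated by its length, the rest by the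
    first-derivative test with \<open>l = r * \<delta>\<close>.\<close>
  have right: "norm (?I c b) \<le> \<delta> + 4 / (r * \<delta> * \<bar>t\<bar>)" if c: "a \<le> c" "c \<le> b" "0 \<le> h' c" for c
  proof (cases "b - c \<le> \<delta>")
    case True
    have "0 \<le> 4 / (r * \<delta> * \<bar>t\<bar>)" using \<open>0 < r\<close> \<open>0 < \<delta>\<close> by simp
    with short[of c b] c True show ?thesis by linarith
  next
    case False
    have "r * \<delta> \<le> \<bar>h' x\<bar>" if "x \<in> {c + \<delta>..b}" for x
    proof -
      have "r * \<delta> \<le> r * (x - c)" using that \<open>0 < r\<close> by auto
      also have "\<dots> \<le> h' x" using growth[of c x] that c \<open>0 < \<delta>\<close> by auto
      finally show ?thesis by simp
    qed
    then have "norm (?I (c + \<delta>) b) \<le> 4 / (r * \<delta> * \<bar>t\<bar>)"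
      using False c \<open>0 < \<delta>\<close> by (intro long) simp_all
    moreover have "norm (?I c (c + \<delta>)) \<le> \<delta>"
      using False c \<open>0 < \<delta>\<close> by (intro short) simp_all
    moreover have "?I c (c + \<delta>) + ?I (c + \<delta>) b = ?I c b"
      using False c \<open>0 < \<delta>\<close> by (intro Henstock_Kurzweil_Integration.integral_combine int) auto
    ultimately show ?thesis
      using norm_triangle_ineq[of "?I c (c + \<delta>)" "?I (c + \<delta>) b"] by simp
  qed
  have left: "norm (?I a c) \<le> \<delta> + 4 / (r * \<delta> * \<bar>t\<bar>)" if c: "a \<le> c" "c \<le> b" "h' c \<le> 0" for c
  proof (cases "c - a \<le> \<delta>")
    case True
    have "0 \<le> 4 / (r * \<delta> * \<bar>t\<bar>)" using \<open>0 < r\<close> \<open>0 < \<delta>\<close> by simp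
    with short[of a c] c True show ?thesis by linarith
  next
    case False
    have "r * \<delta> \<le> \<bar>h' x\<bar>" if "x \<in> {a..c - \<delta>}" for x
    proof -
      have "r * \<delta> \<le> r * (c - x)" using that \<open>0 < r\<close> by auto
      also have "\<dots> \<le> - h' x" using growth[of x c] that c \<open>0 < \<delta>\<close> by auto
      finally show ?thesis by simp
    qed
    then have "norm (?I a (c - \<delta>)) \<le> 4 / (r * \<delta> * \<bar>t\<bar>)"
      using False c \<open>0 < \<delta>\<close> by (intro long) simp_all
    moreover have "norm (?I (c - \<delta>) c) \<le> \<delta>"
      using False c \<open>0 < \<delta>\<close> by (intro short) simp_all
    moreover have "?I a (c - \<delta>) + ?I (c - \<delta>) c = ?I a c"
      using False c \<open>0 < \<delta>\<close> by (intro Henstock_Kurzweil_Integration.integral_combine int) auto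
    ultimately show ?thesis
      using norm_triangle_ineq[of "?I a (c - \<delta>)" "?I (c - \<delta>) c"] by simp
  qed
  have pos: "0 \<le> \<delta> + 4 / (r * \<delta> * \<bar>t\<bar>)" using \<open>0 < r\<close> \<open>0 < \<delta>\<close> by simp
  have eq: "2 * \<delta> + 8 / (r * \<delta> * \<bar>t\<bar>) = (\<delta> + 4 / (r * \<delta> * \<bar>t\<bar>)) + (\<delta> + 4 / (r * \<delta> * \<bar>t\<bar>))"
    by (simp add: add_divide_distrib[symmetric])
  \<comment> \<open>Either \<open>h'\<close> starts nonnegative or ends nonpositive, so that one
    one-sided estimate covers the whole interval, or it has a zero \<open>c\<close> and both
    estimates apply from \<open>c\<close> outwards. The final bound is two copies of the one-sided
    one.\<close>
  consider "0 \<le> h' a" | "h' b \<le> 0" | "h' a \<le> 0" "0 \<le> h' b" by linarith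
  then show ?thesis
  proof cases
    case 1
    then show ?thesis using right[of a] \<open>a \<le> b\<close> pos unfolding eq by linarith
  next
    case 2
    then show ?thesis using left[of b] \<open>a \<le> b\<close> pos unfolding eq by linarith
  next
    case 3
    have "continuous_on {a..b} h'"
      using h' by (meson DERIV_isCont continuous_at_imp_continuous_on)
    then obtain c where c: "a \<le> c" "c \<le> b" "h' c = 0"
      using IVT'[of h' a 0 b] 3 \<open>a \<le> b\<close> by auto
    have "?I a b = ?I a c + ?I c b"
      using c by (intro Henstock_Kurzweil_Integration.integral_combine[symmetric] int) auto
    moreover have "norm (?I a c) \<le> \<delta> + 4 / (r * \<delta> * \<bar>t\<bar>)"
      using c by (intro left) auto
    moreover have "norm (?I c b) \<le> \<delta> + 4 / (r * \<delta> * \<bar>t\<bar>)"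
      using c by (intro right) auto
    ultimately show ?thesis
      unfolding eq by (simp only:) (rule norm_triangle_le add_mono | assumption)+
  qed
qed

section \<open>Moments\<close>

text \<open>Used with \<tau> equal to \<open>min a M\<close>: the error term involves only
  \<open>a\<close> and \<open>d\<close>, so it is free of the truncation level. Each induction step
  multiplies by \<open>\<tau> + d\<close>; the new cross term
  \<open>d * (a\<^sup>2 * \<tau> ^ n)\<close> is at most \<open>d * (a + d) ^ (n + 2)\<close> and
  raises the coefficient by one.\<close>

lemma increment_bound_truncated_power:
  fixes a d \<tau> :: real
  assumes "0 \<le> \<tau>" "\<tau> \<le> a" "0 \<le> d"
  shows "(a + d)\<^sup>2 * (\<tau> + d) ^ n \<le> a\<^sup>2 * \<tau> ^ n + real (n + 2) * d * (a + d) ^ (n + 1)"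
proof (induction n)
  case 0
  have "0 \<le> d\<^sup>2" by simp
  then show ?case using assms by (simp add: power2_eq_square algebra_simps)
next
  case (Suc n)
  have "(a + d)\<^sup>2 * (\<tau> + d) ^ Suc n = (\<tau> + d) * ((a + d)\<^sup>2 * (\<tau> + d) ^ n)" by simp
  also have "\<dots> \<le> (\<tau> + d) * (a\<^sup>2 * \<tau> ^ n + real (n + 2) * d * (a + d) ^ (n + 1))"
    using assms Suc.IH by (intro mult_left_mono) auto
  also have "\<dots> = a\<^sup>2 * \<tau> ^ Suc n + d * (a\<^sup>2 * \<tau> ^ n) + (\<tau> + d) * (real (n + 2) * d * (a + d) ^ (n + 1))"
    by (simp add: algebra_simps)
  also have "\<dots> \<le> a\<^sup>2 * \<tau> ^ Suc n + d * ((a + d)\<^sup>2 * (a + d) ^ n) + (a + d) * (real (n + 2) * d * (a + d) ^ (n + 1))"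
    using assms by (intro add_mono mult_mono power_mono order_refl) auto
  also have "\<dots> = a\<^sup>2 * \<tau> ^ Suc n + real (Suc n + 2) * d * (a + d) ^ (Suc n + 1)"
    by (simp add: algebra_simps power2_eq_square)
  finally show ?case .
qed

text \<open>Only \<open>n\<close> of the \<open>n + 2\<close> factors are truncated. The function is
  thus dominated by a multiple of the square, hence integrable by the finite variance, and the
  intact square supplies the contraction factor in the scaling estimate.\<close>

definition truncated_power :: "real \<Rightarrow> nat \<Rightarrow> real \<Rightarrow> real" where
  "truncated_power M n x = x\<^sup>2 * (min \<bar>x\<bar> M) ^ n"

lemma measurable_truncated_power [measurable]: "truncated_power M n \<in> borel_measurable borel"
  unfolding truncated_power_def by measurable

lemma truncated_power_nonneg: "0 \<le> M \<Longrightarrow> 0 \<le> truncated_power M n x"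
  by (simp add: truncated_power_def)

lemma truncated_power_mono:
  assumes "\<bar>x\<bar> \<le> \<bar>y\<bar>" "0 \<le> M"
  shows "truncated_power M n x \<le> truncated_power M n y"
proof -
  have "x\<^sup>2 \<le> y\<^sup>2" using assms by (simp add: abs_le_square_iff)
  moreover have "(min \<bar>x\<bar> M) ^ n \<le> (min \<bar>y\<bar> M) ^ n" using assms by (intro power_mono) auto
  ultimately show ?thesis
    unfolding truncated_power_def using assms by (intro mult_mono) auto
qed

lemma truncated_power_scale:
  assumes "0 \<le> u" "u \<le> 1" "0 \<le> M"
  shows "truncated_power M n (u * x) \<le> u\<^sup>2 * truncated_power M n x"
proof -
  have "u * \<bar>x\<bar> \<le> 1 * \<bar>x\<bar>" using assms by (intro mult_right_mono) auto
  then have "(u * x)\<^sup>2 * (min \<bar>u * x\<bar> M) ^ n \<le> (u * x)\<^sup>2 * (min \<bar>x\<bar> M) ^ n"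
    using assms by (intro mult_left_mono power_mono) (auto simp: abs_mult)
  then show ?thesis by (simp add: truncated_power_def power_mult_distrib mult_ac)
qed

text \<open>Expand around the larger argument, with the smaller one plus 1 as increment. The error
  is then a product of a function of \<open>a\<close> and a function of \<open>b\<close>, each of
  order \<open>n + 1\<close> only, so for independent variables lower moments control it. The extra
  1 leaves room for the toll term \<open>quicksort_g\<close>.\<close>

lemma truncated_power_add:
  assumes "0 \<le> a" "0 \<le> b" "0 \<le> M"
  shows "truncated_power M n (a + b + 1) \<le> truncated_power M n a + truncated_power M n b
    + real (n + 2) * 2 ^ (n + 1) * ((1 + a) ^ (n + 1) * (1 + b) ^ (n + 1))"
  using assms(1,2)
proof (induction a b rule: linorder_wlog)
  case (sym a b)
  then show ?case by (simp add: ac_simps)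
next
  case (le b a)
  have "truncated_power M n (a + (b + 1)) \<le> (a + (b + 1))\<^sup>2 * (min a M + (b + 1)) ^ n"
    unfolding truncated_power_def using le assms by (intro mult_left_mono power_mono) auto
  also have "\<dots> \<le> a\<^sup>2 * (min a M) ^ n + real (n + 2) * (b + 1) * (a + (b + 1)) ^ (n + 1)"
    using le assms by (intro increment_bound_truncated_power) auto
  \<comment> \<open>As \<open>b\<close> is the smaller argument, \<open>a + b + 1\<close> is at most
    \<open>2 * (1 + a)\<close>, which produces the factor \<open>2 ^ (n + 1)\<close>.\<close>
  also have "real (n + 2) * (b + 1) * (a + (b + 1)) ^ (n + 1) \<le> real (n + 2) * (1 + b) ^ (n + 1) * (2 * (1 + a)) ^ (n + 1)"
    using le by (intro mult_mono power_mono) (auto simp: add.commute intro: self_le_power)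
  also have "\<dots> = real (n + 2) * 2 ^ (n + 1) * ((1 + b) ^ (n + 1) * (1 + a) ^ (n + 1))"
    by (simp only: power_mult_distrib mult_ac)
  also have "a\<^sup>2 * (min a M) ^ n = truncated_power M n a"
    using le by (simp add: truncated_power_def)
  finally show ?case using truncated_power_nonneg[of M n b] assms by (simp add: ac_simps)
qed

text \<open>Apply \<open>x - 1 \<le> x * ln x \<le> 0\<close> to \<open>u\<close> and to
  \<open>1 - u\<close>: the two lower bounds add up to -1, so the value lies between -1 and
  1.\<close>

lemma quicksort_g_bound:
  assumes "0 < u" "u < 1"
  shows "\<bar>quicksort_g u\<bar> \<le> 1"
proof -
  have *: "x - 1 \<le> x * ln x \<and> x * ln x \<le> 0" if "0 < x" "x < 1" for x :: real
  proof
    have "x * (1 - 1 / x) \<le> x * ln x"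
      using ln_le_minus_one[of "1 / x"] that by (intro mult_left_mono) (auto simp: ln_div)
    then show "x - 1 \<le> x * ln x" using that by (simp add: algebra_simps)
  qed (use that in \<open>simp add: mult_nonneg_nonpos\<close>)
  have "quicksort_g u = 2 * (u * ln u) + 2 * ((1 - u) * ln (1 - u)) + 1"
    by (simp add: quicksort_g_def)
  with *[of u] *[of "1 - u"] assms show ?thesis
    by linarith
qed

lemma measurable_quicksort_g [measurable]: "quicksort_g \<in> borel_measurable borel"
  unfolding quicksort_g_def by measurable

section \<open>Integration against the uniform law on the unit interval\<close>

abbreviation unit_uniform :: "real measure" where
  "unit_uniform \<equiv> uniform_measure lborel {0<..<1}"

lemma prob_space_unit_uniform: "prob_space unit_uniform"
  by (intro prob_space_uniform_measure) auto

lemma AE_unit_uniform: "AE u in unit_uniform. 0 < u \<and> u < 1"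
  by (intro AE_uniform_measureI) auto

lemma nn_integral_unit_uniform:
  "f \<in> borel_measurable borel \<Longrightarrow>
    (\<integral>\<^sup>+u. f u \<partial>unit_uniform) = (\<integral>\<^sup>+u. f u * indicator {0<..<1} u \<partial>lborel)"
  by (subst nn_integral_uniform_measure) (auto simp: divide_ennreal_def)

lemma nn_integral_unit_uniform_le:
  assumes f: "\<And>u. u \<in> {0..1} \<Longrightarrow> 0 \<le> f u" "(f has_integral I) {0..1}" "f \<in> borel_measurable borel"
  shows "(\<integral>\<^sup>+u. ennreal (f u) \<partial>unit_uniform) \<le> ennreal I"
proof -
  have "(\<integral>\<^sup>+u. ennreal (f u) \<partial>unit_uniform) = (\<integral>\<^sup>+u. ennreal (f u) * indicator {0<..<1} u \<partial>lborel)"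
    using f by (intro nn_integral_unit_uniform) auto
  also have "\<dots> \<le> (\<integral>\<^sup>+u. ennreal (f u) * indicator {0..1} u \<partial>lborel)"
    by (intro nn_integral_mono mult_left_mono) (auto split: split_indicator)
  also have "\<dots> = ennreal I"
    using f by (intro nn_integral_has_integral_lebesgue') auto
  finally show ?thesis .
qed

lemma integral_unit_uniform:
  fixes f :: "real \<Rightarrow> 'a::{banach, second_countable_topology}"
  assumes "f \<in> borel_measurable borel"
  shows "(\<integral>u. f u \<partial>unit_uniform) = (LINT u:{0<..<1}|lborel. f u)"
proof -
  have "unit_uniform = density lborel (\<lambda>u. ennreal (indicator {0<..<1} u))"
    unfolding uniform_measure_def
    by (intro density_cong) (auto split: split_indicator)
  then show ?thesis
    using assms by (simp add: integral_density set_lebesgue_integral_def)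
qed

section \<open>The distributional fixed-point equation and finiteness of all moments\<close>

locale quicksort_limit =
  fixes \<mu> :: "real measure"
  assumes law: "quicksort_limit_law \<mu>"
begin

sublocale real_distribution \<mu>
  using law by (simp add: quicksort_limit_law_def)

sublocale U: prob_space unit_uniform
  by (rule prob_space_unit_uniform)

sublocale YZ: pair_prob_space \<mu> \<mu> ..

sublocale UYZ: pair_prob_space unit_uniform "\<mu> \<Otimes>\<^sub>M \<mu>" ..

definition transform :: "real \<times> real \<times> real \<Rightarrow> real" where
  "transform = (\<lambda>(u, y, z). u * y + (1 - u) * z + quicksort_g u)"

lemma measurable_transform [measurable]:
  "transform \<in> borel_measurable (unit_uniform \<Otimes>\<^sub>M (\<mu> \<Otimes>\<^sub>M \<mu>))"
  unfolding transform_def by measurable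

lemma distr_transform: "distr (unit_uniform \<Otimes>\<^sub>M (\<mu> \<Otimes>\<^sub>M \<mu>)) borel transform = \<mu>"
  using law by (simp add: quicksort_limit_law_def transform_def)

text \<open>Stated for the nonnegative integral so that it can be applied before any higher moment
  is known to be finite.\<close>

lemma nn_integral_fixed_point:
  assumes [measurable]: "f \<in> borel_measurable borel"
  shows "(\<integral>\<^sup>+x. f x \<partial>\<mu>) = (\<integral>\<^sup>+u. \<integral>\<^sup>+y. \<integral>\<^sup>+z. f (u * y + (1 - u) * z + quicksort_g u) \<partial>\<mu> \<partial>\<mu> \<partial>unit_uniform)"
proof -
  have "(\<integral>\<^sup>+x. f x \<partial>\<mu>) = (\<integral>\<^sup>+w. f (transform w) \<partial>(unit_uniform \<Otimes>\<^sub>M (\<mu> \<Otimes>\<^sub>M \<mu>)))"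
    by (subst distr_transform[symmetric], subst nn_integral_distr) auto
  also have "\<dots> = (\<integral>\<^sup>+u. \<integral>\<^sup>+v. f (transform (u, v)) \<partial>(\<mu> \<Otimes>\<^sub>M \<mu>) \<partial>unit_uniform)"
    by (subst YZ.P.nn_integral_fst) measurable
  also have "\<dots> = (\<integral>\<^sup>+u. \<integral>\<^sup>+y. \<integral>\<^sup>+z. f (transform (u, y, z)) \<partial>\<mu> \<partial>\<mu> \<partial>unit_uniform)"
  proof (intro nn_integral_cong)
    fix u :: real
    show "(\<integral>\<^sup>+v. f (transform (u, v)) \<partial>(\<mu> \<Otimes>\<^sub>M \<mu>)) = (\<integral>\<^sup>+y. \<integral>\<^sup>+z. f (transform (u, y, z)) \<partial>\<mu> \<partial>\<mu>)"
      unfolding transform_def by (subst nn_integral_fst[symmetric]) auto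
  qed
  finally show ?thesis by (simp add: transform_def)
qed

text \<open>For every truncation level the truncated moment \<open>A\<close> satisfies
  \<open>A \<le> 2/3 * A + K * W * W\<close>, where 2/3 is the sum of the second moments of
  \<open>U\<close> and \<open>1 - U\<close>. This gives a bound independent of the level, and
  monotone convergence removes the truncation.\<close>

lemma nn_integral_moment_step:
  assumes n: "(\<integral>\<^sup>+x. ennreal ((1 + \<bar>x\<bar>) ^ (n + 1)) \<partial>\<mu>) < \<infinity>"
  shows "(\<integral>\<^sup>+x. ennreal (\<bar>x\<bar> ^ (n + 2)) \<partial>\<mu>) < \<infinity>"
proof -
  define w where "w x = (1 + \<bar>x\<bar>) ^ (n + 1)" for x :: real
  define W where "W = (\<integral>\<^sup>+x. ennreal (w x) \<partial>\<mu>)"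
  define K :: real where "K = real (n + 2) * 2 ^ (n + 1)"
  have [measurable]: "w \<in> borel_measurable borel" unfolding w_def by measurable
  have w0: "0 \<le> w x" for x by (simp add: w_def)
  have K0: "0 \<le> K" by (simp add: K_def)
  have W: "W < \<infinity>" using n by (simp add: W_def w_def)
  have u1: "(\<integral>\<^sup>+u. ennreal (u\<^sup>2) \<partial>unit_uniform) \<le> ennreal (1/3)"
    by (rule nn_integral_unit_uniform_le)
      (auto intro!: has_integral_eq_rhs[OF fundamental_theorem_of_calculus[where f = "\<lambda>x. x ^ 3 / 3"]] derivative_eq_intros simp: has_real_derivative_iff_has_vector_derivative[symmetric])
  have u2: "(\<integral>\<^sup>+u. ennreal ((1 - u)\<^sup>2) \<partial>unit_uniform) \<le> ennreal (1/3)"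
    by (rule nn_integral_unit_uniform_le)
      (auto intro!: has_integral_eq_rhs[OF fundamental_theorem_of_calculus[where f = "\<lambda>x. (x - 1) ^ 3 / 3"]] derivative_eq_intros simp: has_real_derivative_iff_has_vector_derivative[symmetric] power2_commute)
  have bound: "(\<integral>\<^sup>+x. ennreal (truncated_power M n x) \<partial>\<mu>) \<le> 3 * (ennreal K * W * W)" if M: "0 \<le> M" for M
  proof -
    define A where "A = (\<integral>\<^sup>+x. ennreal (truncated_power M n x) \<partial>\<mu>)"
    \<comment> \<open>Finiteness of \<open>A\<close> comes first, since otherwise
      \<open>2/3 * A\<close> could not be subtracted from both sides below. It follows from the
      second moment.\<close>
    have "truncated_power M n x \<le> x\<^sup>2 * M ^ n" for x
      unfolding truncated_power_def using M by (intro mult_left_mono power_mono) auto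
    then have "A \<le> (\<integral>\<^sup>+x. ennreal (M ^ n) * ennreal (x\<^sup>2) \<partial>\<mu>)"
      unfolding A_def using M
      by (intro nn_integral_mono) (simp add: ennreal_mult[symmetric] mult.commute ennreal_leI)
    also have "\<dots> = ennreal (M ^ n) * (\<integral>\<^sup>+x. ennreal (x\<^sup>2) \<partial>\<mu>)"
      by (intro nn_integral_cmult) measurable
    also have "\<dots> < \<infinity>"
      using law by (auto simp: quicksort_limit_law_def integrable_iff_bounded ennreal_mult_less_top)
    finally have A: "A < \<infinity>" .
    have pt: "ennreal (truncated_power M n (u * y + (1 - u) * z + quicksort_g u)) \<le>
        ennreal (u\<^sup>2) * ennreal (truncated_power M n y) + ennreal ((1 - u)\<^sup>2) * ennreal (truncated_power M n z)
        + ennreal K * ennreal (w y) * ennreal (w z)"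
      if u: "0 < u" "u < 1" for u y z
    proof -
      have "truncated_power M n (u * y + (1 - u) * z + quicksort_g u) \<le> truncated_power M n (u * \<bar>y\<bar> + (1 - u) * \<bar>z\<bar> + 1)"
      proof (intro truncated_power_mono M)
        have "\<bar>u * y + (1 - u) * z + quicksort_g u\<bar> \<le> \<bar>u * y\<bar> + \<bar>(1 - u) * z\<bar> + \<bar>quicksort_g u\<bar>"
          by linarith
        also have "\<dots> \<le> u * \<bar>y\<bar> + (1 - u) * \<bar>z\<bar> + 1"
          using quicksort_g_bound[OF u] u by (simp add: abs_mult)
        finally show "\<bar>u * y + (1 - u) * z + quicksort_g u\<bar> \<le> \<bar>u * \<bar>y\<bar> + (1 - u) * \<bar>z\<bar> + 1\<bar>"
          by linarith
      qed
      also have "\<dots> \<le> truncated_power M n (u * \<bar>y\<bar>) + truncated_power M n ((1 - u) * \<bar>z\<bar>)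
          + K * ((1 + u * \<bar>y\<bar>) ^ (n + 1) * (1 + (1 - u) * \<bar>z\<bar>) ^ (n + 1))"
        unfolding K_def using u M by (intro truncated_power_add) auto
      also have "\<dots> \<le> u\<^sup>2 * truncated_power M n y + (1 - u)\<^sup>2 * truncated_power M n z + K * (w y * w z)"
      proof (intro add_mono mult_left_mono K0)
        have "truncated_power M n \<bar>x\<bar> = truncated_power M n x" for x by (simp add: truncated_power_def)
        then show "truncated_power M n (u * \<bar>y\<bar>) \<le> u\<^sup>2 * truncated_power M n y"
          "truncated_power M n ((1 - u) * \<bar>z\<bar>) \<le> (1 - u)\<^sup>2 * truncated_power M n z"
          using truncated_power_scale[of u M n "\<bar>y\<bar>"] truncated_power_scale[of "1 - u" M n "\<bar>z\<bar>"] u M by auto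
        show "(1 + u * \<bar>y\<bar>) ^ (n + 1) * (1 + (1 - u) * \<bar>z\<bar>) ^ (n + 1) \<le> w y * w z"
          unfolding w_def using u by (intro mult_mono power_mono) (auto intro: mult_left_le_one_le)
      qed
      finally have "ennreal (truncated_power M n (u * y + (1 - u) * z + quicksort_g u)) \<le>
          ennreal (u\<^sup>2 * truncated_power M n y + (1 - u)\<^sup>2 * truncated_power M n z + K * (w y * w z))"
        by (rule ennreal_leI)
      also have "\<dots> = ennreal (u\<^sup>2) * ennreal (truncated_power M n y) + ennreal ((1 - u)\<^sup>2) * ennreal (truncated_power M n z)
        + ennreal K * ennreal (w y) * ennreal (w z)"
        using K0 w0 truncated_power_nonneg[OF M] by (simp add: ennreal_mult' mult.assoc)
      finally show ?thesis .
    qed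
    have "A = (\<integral>\<^sup>+u. \<integral>\<^sup>+y. \<integral>\<^sup>+z. ennreal (truncated_power M n (u * y + (1 - u) * z + quicksort_g u)) \<partial>\<mu> \<partial>\<mu> \<partial>unit_uniform)"
      unfolding A_def by (intro nn_integral_fixed_point) measurable
    also have "\<dots> \<le> (\<integral>\<^sup>+u. \<integral>\<^sup>+y. \<integral>\<^sup>+z. ennreal (u\<^sup>2) * ennreal (truncated_power M n y) + ennreal ((1 - u)\<^sup>2) * ennreal (truncated_power M n z)
        + ennreal K * ennreal (w y) * ennreal (w z) \<partial>\<mu> \<partial>\<mu> \<partial>unit_uniform)"
      by (intro nn_integral_mono_AE eventually_mono[OF AE_unit_uniform]) (auto intro!: nn_integral_mono pt)
    \<comment> \<open>For fixed \<open>u\<close> the iterated integral over \<open>y\<close> and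
      \<open>z\<close> factorises: each quadratic term yields \<open>A\<close>, and the product of
      weights yields \<open>W * W\<close>.\<close>
    also have "\<dots> = (\<integral>\<^sup>+u. ennreal (u\<^sup>2) * A + ennreal ((1 - u)\<^sup>2) * A + ennreal K * W * W \<partial>unit_uniform)"
      by (simp add: nn_integral_add nn_integral_cmult nn_integral_multc A_def[symmetric] W_def[symmetric]
          emeasure_space_1[simplified])
    also have "\<dots> = (\<integral>\<^sup>+u. ennreal (u\<^sup>2) \<partial>unit_uniform) * A + (\<integral>\<^sup>+u. ennreal ((1 - u)\<^sup>2) \<partial>unit_uniform) * A + ennreal K * W * W"
      using U.emeasure_space_1 by (simp add: nn_integral_add nn_integral_multc)
    also have "\<dots> \<le> ennreal (1/3) * A + ennreal (1/3) * A + ennreal K * W * W"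
      by (intro add_mono mult_right_mono u1 u2) auto
    finally have le: "A \<le> ennreal (1/3) * A + ennreal (1/3) * A + ennreal K * W * W" .
    obtain a where a: "0 \<le> a" "A = ennreal a" using A by (cases A) auto
    obtain v where v: "0 \<le> v" "W = ennreal v" using W by (cases W) auto
    from le have "a \<le> 1/3 * a + 1/3 * a + K * v * v"
      using a v K0 by (simp add: ennreal_mult[symmetric] ennreal_plus[symmetric] del: ennreal_plus)
    then have "a \<le> 3 * (K * v * v)" by simp
    then show ?thesis
      using a v K0 unfolding A_def[symmetric]
      by (simp add: ennreal_mult[symmetric] ennreal_numeral[symmetric] del: ennreal_numeral)
  qed
  have "(\<lambda>i. \<integral>\<^sup>+x. ennreal (truncated_power (real i) n x) \<partial>\<mu>) \<longlonglongrightarrow> (\<integral>\<^sup>+x. ennreal (\<bar>x\<bar> ^ (n + 2)) \<partial>\<mu>)"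
  proof (rule nn_integral_LIMSEQ)
    show "incseq (\<lambda>i x. ennreal (truncated_power (real i) n x))"
      unfolding truncated_power_def incseq_def le_fun_def
      by (auto intro!: ennreal_leI mult_left_mono power_mono)
    show "(\<lambda>i. ennreal (truncated_power (real i) n x)) \<longlonglongrightarrow> ennreal (\<bar>x\<bar> ^ (n + 2))" for x
    \<comment> \<open>At each point the truncation is inactive as soon as the level exceeds the
      absolute value, so the sequence is eventually constant.\<close>
    proof (rule tendsto_eventually)
      obtain N where N: "\<bar>x\<bar> \<le> real N" using real_arch_simple by blast
      have "truncated_power (real i) n x = \<bar>x\<bar> ^ (n + 2)" if "N \<le> i" for i
        using N that by (simp add: truncated_power_def power_add min_absorb1 mult.commute power2_eq_square)
      then show "\<forall>\<^sub>F i in sequentially. ennreal (truncated_power (real i) n x) = ennreal (\<bar>x\<bar> ^ (n + 2))"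
        unfolding eventually_sequentially by metis
    qed
  qed measurable
  then have "(\<integral>\<^sup>+x. ennreal (\<bar>x\<bar> ^ (n + 2)) \<partial>\<mu>) \<le> 3 * (ennreal K * W * W)"
    by (rule LIMSEQ_le_const2) (use bound in auto)
  also have "\<dots> < \<infinity>" using W by (simp add: ennreal_mult_less_top)
  finally show ?thesis .
qed

lemma nn_integral_moment: "(\<integral>\<^sup>+x. ennreal ((1 + \<bar>x\<bar>) ^ (n + 1)) \<partial>\<mu>) < \<infinity>"
proof (induction n)
  case 0
  have "integrable \<mu> (\<lambda>x. 1 + \<bar>x\<bar>)"
    using law by (auto simp: quicksort_limit_law_def)
  then show ?case by (simp add: integrable_iff_bounded)
next
  case (Suc n)
  have le: "(1 + \<bar>x\<bar>) ^ (n + 2) \<le> 2 ^ (n + 2) * (1 + \<bar>x\<bar> ^ (n + 2))" for x :: real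
  proof -
    have "(1 + \<bar>x\<bar>) ^ (n + 2) \<le> (2 * max 1 \<bar>x\<bar>) ^ (n + 2)" by (intro power_mono) auto
    also have "\<dots> = 2 ^ (n + 2) * (max 1 \<bar>x\<bar>) ^ (n + 2)" by (simp only: power_mult_distrib)
    also have "\<dots> \<le> 2 ^ (n + 2) * (1 + \<bar>x\<bar> ^ (n + 2))"
      by (intro mult_left_mono) (auto simp: max_def)
    finally show ?thesis .
  qed
  have "(\<integral>\<^sup>+x. ennreal ((1 + \<bar>x\<bar>) ^ (n + 2)) \<partial>\<mu>) \<le>
      (\<integral>\<^sup>+x. ennreal (2 ^ (n + 2)) * (1 + ennreal (\<bar>x\<bar> ^ (n + 2))) \<partial>\<mu>)"
  proof (intro nn_integral_mono)
    fix x :: real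
    have "ennreal ((1 + \<bar>x\<bar>) ^ (n + 2)) \<le> ennreal (2 ^ (n + 2) * (1 + \<bar>x\<bar> ^ (n + 2)))"
      using le by (rule ennreal_leI)
    then show "ennreal ((1 + \<bar>x\<bar>) ^ (n + 2)) \<le> ennreal (2 ^ (n + 2)) * (1 + ennreal (\<bar>x\<bar> ^ (n + 2)))"
      by (simp only: ennreal_mult' zero_le_power zero_le_numeral ennreal_plus abs_ge_zero zero_le_one ennreal_1)
  qed
  also have "\<dots> = ennreal (2 ^ (n + 2)) * (1 + (\<integral>\<^sup>+x. ennreal (\<bar>x\<bar> ^ (n + 2)) \<partial>\<mu>))"
    using emeasure_space_1 by (subst nn_integral_cmult) (auto simp: nn_integral_add)
  also have "\<dots> < \<infinity>"
    using nn_integral_moment_step[OF Suc.IH] by (simp add: ennreal_mult_less_top)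
  finally show ?case by simp
qed

lemma integrable_abs_moment: "integrable \<mu> (\<lambda>x. \<bar>x\<bar> ^ n)"
proof (rule Bochner_Integration.integrable_bound)
  show "integrable \<mu> (\<lambda>x. (1 + \<bar>x\<bar>) ^ (n + 1))"
    using nn_integral_moment[of n] by (intro integrableI_nonneg) auto
  have "\<bar>x\<bar> ^ n \<le> (1 + \<bar>x\<bar>) ^ (n + 1)" for x :: real
    by (rule order_trans[OF power_mono power_increasing]) auto
  then show "AE x in \<mu>. norm (\<bar>x\<bar> ^ n) \<le> norm ((1 + \<bar>x\<bar>) ^ (n + 1))"
    by (auto simp: power_abs[symmetric])
qed measurable

end

section \<open>Smoothness and interpolation\<close>

text \<open>Taylor expansion of \<open>iexp (s * x)\<close> to first order under the integral. The
  remainder is quadratic in \<open>s\<close> and uniform in \<open>t\<close>, which serves twice: it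
  gives differentiability and it is the input of the interpolation argument.\<close>

lemma (in real_distribution) moment_transform_difference:
  fixes \<psi> :: "nat \<Rightarrow> real \<Rightarrow> complex"
  defines "\<psi> \<equiv> \<lambda>k t. \<integral>x. (\<i> * x) ^ k * iexp (t * x) \<partial>M"
  assumes mom: "\<And>k. integrable M (\<lambda>x. \<bar>x\<bar> ^ k)"
  shows "norm (\<psi> k (t + s) - \<psi> k t - s * \<psi> (Suc k) t) \<le> s\<^sup>2 / 2 * (\<integral>x. \<bar>x\<bar> ^ (k + 2) \<partial>M)"
proof -
  have int: "integrable M (\<lambda>x. (\<i> * x) ^ k * iexp (t * x))" for k t
    by (rule Bochner_Integration.integrable_bound[OF mom[of k]]) (auto simp: norm_mult norm_power)
  have "\<psi> k (t + s) - \<psi> k t - s * \<psi> (Suc k) t =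
      (\<integral>x. (\<i> * x) ^ k * iexp ((t + s) * x) - (\<i> * x) ^ k * iexp (t * x) - s * ((\<i> * x) ^ Suc k * iexp (t * x)) \<partial>M)"
    unfolding \<psi>_def using int[of k "t + s"] int[of k t] int[of "Suc k" t]
    by (simp only: Bochner_Integration.integral_diff Bochner_Integration.integrable_diff
      integral_mult_right_zero integrable_mult_right)
  also have "norm \<dots> \<le> (\<integral>x. s\<^sup>2 / 2 * \<bar>x\<bar> ^ (k + 2) \<partial>M)"
  proof (rule Bochner_Integration.integral_norm_bound_integral)
    fix x :: real
    have "norm ((\<i> * x) ^ k * iexp ((t + s) * x) - (\<i> * x) ^ k * iexp (t * x) - s * ((\<i> * x) ^ Suc k * iexp (t * x)))
      = norm ((\<i> * x) ^ k * iexp (t * x) * (iexp (s * x) - (\<Sum>j\<le>1. (\<i> * (s * x)) ^ j / fact j)))"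
      by (simp add: exp_add[symmetric] algebra_simps)
    also have "\<dots> = \<bar>x\<bar> ^ k * norm (iexp (s * x) - (\<Sum>j\<le>1. (\<i> * complex_of_real (s * x)) ^ j / fact j))"
      by (simp add: norm_mult norm_power)
    also have "\<dots> \<le> \<bar>x\<bar> ^ k * (\<bar>s * x\<bar> ^ Suc 1 / fact (Suc 1))"
      by (intro mult_left_mono iexp_approx1) auto
    also have "\<dots> = s\<^sup>2 / 2 * \<bar>x\<bar> ^ (k + 2)"
      by (simp add: power_add abs_mult power2_eq_square[symmetric] power_mult_distrib)
    finally show "norm ((\<i> * x) ^ k * iexp ((t + s) * x) - (\<i> * x) ^ k * iexp (t * x) - s * ((\<i> * x) ^ Suc k * iexp (t * x))) \<le> s\<^sup>2 / 2 * \<bar>x\<bar> ^ (k + 2)" .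
  qed (intro Bochner_Integration.integrable_diff integrable_mult_right int mom)+
  finally show ?thesis by simp
qed

lemma has_vector_derivative_quadratic_remainder:
  fixes f :: "real \<Rightarrow> complex" and d :: complex
  assumes "\<And>s. norm (f (t + s) - f t - s * d) \<le> s\<^sup>2 * C"
  shows "(f has_vector_derivative d) (at t)"
proof -
  have "((\<lambda>s. norm (f (t + s) - f t - s *\<^sub>R d) / norm s) \<longlongrightarrow> 0) (at 0)"
  proof (rule Lim_null_comparison)
    have "norm (norm (f (t + s) - f t - s *\<^sub>R d) / norm s) \<le> \<bar>s\<bar> * C" if "s \<noteq> 0" for s
    proof -
      have "norm (f (t + s) - f t - s *\<^sub>R d) / \<bar>s\<bar> \<le> s\<^sup>2 * C / \<bar>s\<bar>"
        using assms[of s] by (intro divide_right_mono) (auto simp: scaleR_conv_of_real)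
      also have "\<dots> = \<bar>s\<bar> * C" using that by (simp add: power2_eq_square abs_if)
      finally show ?thesis by simp
    qed
    then show "\<forall>\<^sub>F s in at 0. norm (norm (f (t + s) - f t - s *\<^sub>R d) / norm s) \<le> \<bar>s\<bar> * C"
      by (auto simp: eventually_at_filter)
    show "((\<lambda>s. \<bar>s\<bar> * C) \<longlongrightarrow> 0) (at 0)"
      by (auto intro!: tendsto_eq_intros)
  qed
  then show ?thesis
    unfolding has_vector_derivative_def has_derivative_at using bounded_linear_scaleR_left by blast
qed

text \<open>Integer exponents and arguments away from 0 suffice here, because boundedness takes care
  of small arguments and rounding up takes care of real exponents.\<close>

definition rapidly_decreasing :: "(real \<Rightarrow> complex) \<Rightarrow> bool" where
  "rapidly_decreasing f \<longleftrightarrow> (\<forall>m::nat. \<exists>C. \<forall>t. 1 \<le> \<bar>t\<bar> \<longrightarrow> norm (f t) \<le> C / \<bar>t\<bar> ^ m)"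

text \<open>Landau's interpolation argument: use a step of length \<open>1 / \<bar>t\<bar> ^ m\<close>, directed away from
  0, and the decay of \<open>f\<close> of order \<open>2 * m\<close>.\<close>

lemma rapidly_decreasing_derivative:
  fixes f d :: "real \<Rightarrow> complex"
  assumes f: "rapidly_decreasing f"
    and d: "\<And>t s. norm (f (t + s) - f t - s * d t) \<le> s\<^sup>2 * B"
  shows "rapidly_decreasing d"
  unfolding rapidly_decreasing_def
proof
  fix m :: nat
  obtain C where C: "norm (f t) \<le> C / \<bar>t\<bar> ^ (2 * m)" if "1 \<le> \<bar>t\<bar>" for t
    using f unfolding rapidly_decreasing_def by blast
  have C0: "0 \<le> C" using order_trans[OF norm_ge_zero C[of 1]] by simp
  have "norm (d t) \<le> (2 * C + B) / \<bar>t\<bar> ^ m" if t: "1 \<le> \<bar>t\<bar>" for t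
  proof -
    define q where "q = \<bar>t\<bar> ^ m"
    have q: "0 < q" using t by (simp add: q_def)
    have q2: "\<bar>t\<bar> ^ (2 * m) = q\<^sup>2" by (simp add: q_def power_mult[symmetric] mult.commute)
    define s where "s = sgn t / q"
    have abs_ts: "\<bar>t\<bar> \<le> \<bar>t + s\<bar>"
    proof -
      have "0 < 1 / q" using q by simp
      moreover have "s = (if t > 0 then 1 / q else - (1 / q))" using t by (auto simp: s_def)
      ultimately show ?thesis using t by (smt (verit))
    qed
    have s: "\<bar>s\<bar> = 1 / q" "s\<^sup>2 = 1 / q\<^sup>2"
      using t q by (auto simp: s_def abs_div abs_sgn_eq power_divide sgn_if)
    have "norm (f (t + s)) \<le> C / \<bar>t + s\<bar> ^ (2 * m)"
      using t abs_ts by (intro C) auto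
    also have "\<dots> \<le> C / \<bar>t\<bar> ^ (2 * m)"
      using t abs_ts C0 by (intro divide_left_mono power_mono mult_pos_pos zero_less_power) auto
    finally have fts: "norm (f (t + s)) \<le> C / q\<^sup>2" by (simp add: q2)
    have ft: "norm (f t) \<le> C / q\<^sup>2" using C[OF t] by (simp add: q2)
    \<comment> \<open>Solve the expansion at \<open>t\<close> for the derivative term. The two
      values of \<open>f\<close> and the quadratic remainder are all of order
      \<open>1 / q\<^sup>2\<close>, while the derivative carries only one factor
      \<open>1 / q\<close>.\<close>
    have "norm (d t) / q = norm (s * d t)"
      by (simp add: norm_mult s)
    also have "\<dots> = norm (f (t + s) - f t - (f (t + s) - f t - s * d t))" by simp
    also have "\<dots> \<le> norm (f (t + s)) + norm (f t) + norm (f (t + s) - f t - s * d t)"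
      by (rule order_trans[OF norm_triangle_ineq4 add_right_mono[OF norm_triangle_ineq4]])
    also have "\<dots> \<le> C / q\<^sup>2 + C / q\<^sup>2 + 1 / q\<^sup>2 * B"
      using fts ft d[of t s] by (intro add_mono) (simp_all add: s)
    also have "\<dots> = (2 * C + B) / q / q"
      by (simp add: add_divide_distrib power2_eq_square)
    finally show ?thesis
      using q unfolding q_def[symmetric] by (metis divide_le_cancel)
  qed
  then show "\<exists>C. \<forall>t. 1 \<le> \<bar>t\<bar> \<longrightarrow> norm (d t) \<le> C / \<bar>t\<bar> ^ m" by blast
qed

section \<open>Decay of the characteristic function\<close>

text \<open>The integrand blows up at both ends, but the antiderivative is continuous on the closed
  interval, so differentiability in the interior is enough. This is the integral that arises when
  the decay is iterated.\<close>

lemma has_integral_inverse_sqrt_sum: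
  "((\<lambda>u. 1 / sqrt u + 1 / sqrt (1 - u)) has_integral 4) {0..1::real}"
proof -
  have "((\<lambda>u. 1 / sqrt u + 1 / sqrt (1 - u)) has_integral
      (2 * sqrt 1 - 2 * sqrt (1 - 1)) - (2 * sqrt 0 - 2 * sqrt (1 - 0))) {0..1::real}"
    by (intro fundamental_theorem_of_calculus_interior[where f = "\<lambda>u. 2 * sqrt u - 2 * sqrt (1 - u)"] continuous_intros)
      (auto intro!: derivative_eq_intros simp: has_real_derivative_iff_has_vector_derivative[symmetric] field_simps)
  then show ?thesis by simp
qed

text \<open>The derivative of \<open>quicksort_g\<close> is unbounded near 0 and 1, so the
  oscillatory estimate is applied away from the ends; the discarded set has measure
  \<open>2 * \<delta>\<close>.\<close>

lemma norm_integral_unit_uniform_diff: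
  fixes f :: "real \<Rightarrow> complex"
  assumes f[measurable]: "f \<in> borel_measurable borel" and bound: "\<And>u. norm (f u) \<le> 1"
    and \<delta>: "0 < \<delta>" "\<delta> < 1/2" and int: "f integrable_on {\<delta>..1-\<delta>}"
  shows "norm ((\<integral>u. f u \<partial>unit_uniform) - integral {\<delta>..1-\<delta>} f) \<le> 2 * \<delta>"
proof -
  have i: "set_integrable lborel {0<..<1} f" "set_integrable lborel {\<delta>..1-\<delta>} f"
    unfolding set_integrable_def using bound \<delta>
    by (auto intro!: integrableI_bounded_set_indicator[where B = 1])
  have "(\<integral>u. f u \<partial>unit_uniform) - integral {\<delta>..1-\<delta>} f = (LINT u:{0<..<1}|lborel. f u) - (LINT u:{\<delta>..1-\<delta>}|lborel. f u)"
    using i by (simp add: integral_unit_uniform set_borel_integral_eq_integral)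
  also have "\<dots> = (LINT u|lborel. indicator {0<..<1} u *\<^sub>R f u - indicator {\<delta>..1-\<delta>} u *\<^sub>R f u)"
    using i unfolding set_lebesgue_integral_def set_integrable_def
    by (intro Bochner_Integration.integral_diff[symmetric]) auto
  also have "norm \<dots> \<le> (LINT u|lborel. indicator {0<..<1} u - indicator {\<delta>..1-\<delta>} u)"
    using i \<delta> bound unfolding set_integrable_def
    by (intro Bochner_Integration.integral_norm_bound_integral Bochner_Integration.integrable_diff)
      (auto split: split_indicator intro!: integrable_real_indicator)
  also have "\<dots> = 2 * \<delta>"
    using \<delta> by (subst Bochner_Integration.integral_diff) (auto)
  finally show ?thesis .
qed

lemma DERIV_quicksort_g:
  assumes "0 < u" "u < 1"
  shows "(quicksort_g has_real_derivative 2 * ln u - 2 * ln (1 - u)) (at u)"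
    "((\<lambda>u. 2 * ln u - 2 * ln (1 - u)) has_real_derivative 2 / u + 2 / (1 - u)) (at u)"
  unfolding quicksort_g_def using assms
  by (auto intro!: derivative_eq_intros simp: algebra_simps) (simp add: field_simps)

lemma quicksort_oscillatory_integral:
  assumes "t \<noteq> 0"
  shows "norm (\<integral>u. iexp (t * (u * y + (1 - u) * z + quicksort_g u)) \<partial>unit_uniform) \<le> 8 / sqrt \<bar>t\<bar>"
proof -
  define h where "h u = u * y + (1 - u) * z + quicksort_g u" for u
  define f where "f u = iexp (t * h u)" for u
  \<comment> \<open>The same \<delta> serves as cutoff at the ends and as radius in the
    second-derivative test with \<open>r = 2\<close>. This choice makes
    \<open>8 / (2 * \<delta> * \<bar>t\<bar>)\<close> equal to \<open>4 * \<delta>\<close>, for a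
    total of \<open>2 * \<delta> + 6 * \<delta>\<close>. If \<delta> is at least 1/2, the trivial
    bound 1 is good enough.\<close>
  define \<delta> where "\<delta> = 1 / sqrt \<bar>t\<bar>"
  have \<delta>: "0 < \<delta>" using assms by (simp add: \<delta>_def)
  have [measurable]: "f \<in> borel_measurable borel" unfolding f_def h_def by measurable
  have f1: "norm (f u) \<le> 1" for u by (simp add: f_def)
  have "norm (\<integral>u. f u \<partial>unit_uniform) \<le> 8 * \<delta>"
  proof (cases "\<delta> < 1/2")
    case True
    have h: "(h has_real_derivative y - z + (2 * ln u - 2 * ln (1 - u))) (at u)"
      and h': "((\<lambda>u. y - z + (2 * ln u - 2 * ln (1 - u))) has_real_derivative 2 / u + 2 / (1 - u)) (at u)"
      if "u \<in> {\<delta>..1-\<delta>}" for u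
      unfolding h_def using that \<delta> by (auto intro!: derivative_eq_intros DERIV_quicksort_g)
    have "2 \<le> 2 / u + 2 / (1 - u)" if "u \<in> {\<delta>..1-\<delta>}" for u :: real
    proof -
      have "0 < u" "u < 1" using that \<delta> by auto
      then have "2 \<le> 2 / u" "0 \<le> 2 / (1 - u)" by (auto simp: field_simps)
      then show ?thesis by linarith
    qed
    then have "norm (integral {\<delta>..1-\<delta>} f) \<le> 2 * \<delta> + 8 / (2 * \<delta> * \<bar>t\<bar>)"
      unfolding f_def using True \<delta> assms
      by (intro oscillatory_integral_second_derivative[OF _ _ _ _ h h']) auto
    also have "8 / (2 * \<delta> * \<bar>t\<bar>) = 4 * \<delta>"
    proof -
      have "\<bar>t\<bar> = sqrt \<bar>t\<bar> * sqrt \<bar>t\<bar>" by simp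
      then show ?thesis unfolding \<delta>_def using assms by (simp add: field_simps)
    qed
    finally have *: "norm (integral {\<delta>..1-\<delta>} f) \<le> 6 * \<delta>" by simp
    have "continuous_on {\<delta>..1-\<delta>} h"
      using h by (meson DERIV_isCont continuous_at_imp_continuous_on)
    then have "f integrable_on {\<delta>..1-\<delta>}"
      unfolding f_def by (intro integrable_continuous_real continuous_intros)
    from norm_integral_unit_uniform_diff[OF _ f1 \<delta> True this]
    have "norm ((\<integral>u. f u \<partial>unit_uniform) - integral {\<delta>..1-\<delta>} f) \<le> 2 * \<delta>" by simp
    then show ?thesis
      using * norm_triangle_sub[of "\<integral>u. f u \<partial>unit_uniform" "integral {\<delta>..1-\<delta>} f"] by linarith
  next
    case False
    interpret prob_space unit_uniform by (rule prob_space_unit_uniform)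
    have "norm (\<integral>u. f u \<partial>unit_uniform) \<le> (\<integral>u. 1 \<partial>unit_uniform)"
      using f1 by (intro Bochner_Integration.integral_norm_bound_integral integrable_const_bound[where B = 1]) auto
    also have "\<dots> \<le> 8 * \<delta>" using False prob_space by simp
    finally show ?thesis .
  qed
  then show ?thesis by (simp add: f_def h_def \<delta>_def)
qed

section \<open>The fixed-point equation for the characteristic function and its iteration\<close>

context quicksort_limit begin

lemma char_eq_integral_transform:
  "char \<mu> t = (\<integral>w. iexp (t * transform w) \<partial>(unit_uniform \<Otimes>\<^sub>M (\<mu> \<Otimes>\<^sub>M \<mu>)))"
proof -
  have "char \<mu> t = char (distr (unit_uniform \<Otimes>\<^sub>M (\<mu> \<Otimes>\<^sub>M \<mu>)) borel transform) t"
    by (simp add: distr_transform)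
  also have "\<dots> = (\<integral>w. iexp (t * transform w) \<partial>(unit_uniform \<Otimes>\<^sub>M (\<mu> \<Otimes>\<^sub>M \<mu>)))"
    unfolding char_def by (rule integral_distr) measurable
  finally show ?thesis .
qed

lemma integrable_iexp_transform:
  "integrable (unit_uniform \<Otimes>\<^sub>M (\<mu> \<Otimes>\<^sub>M \<mu>)) (\<lambda>w. iexp (t * transform w))"
  by (rule UYZ.P.integrable_const_bound[where B = 1]) auto

lemma char_fixed_point:
  "char \<mu> t = (\<integral>u. iexp (t * quicksort_g u) * (char \<mu> (t * u) * char \<mu> (t * (1 - u))) \<partial>unit_uniform)"
proof -
  have "(\<integral>v. iexp (t * transform (u, v)) \<partial>(\<mu> \<Otimes>\<^sub>M \<mu>)) =
      iexp (t * quicksort_g u) * (char \<mu> (t * u) * char \<mu> (t * (1 - u)))" for u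
  proof -
    have int: "integrable (\<mu> \<Otimes>\<^sub>M \<mu>) (\<lambda>v. iexp (t * u * fst v) * iexp (t * (1 - u) * snd v))"
      by (rule YZ.P.integrable_const_bound[where B = 1]) (auto simp: norm_mult)
    have "(\<integral>v. iexp (t * transform (u, v)) \<partial>(\<mu> \<Otimes>\<^sub>M \<mu>)) =
        (\<integral>v. iexp (t * quicksort_g u) * (iexp (t * u * fst v) * iexp (t * (1 - u) * snd v)) \<partial>(\<mu> \<Otimes>\<^sub>M \<mu>))"
      by (intro Bochner_Integration.integral_cong)
        (auto simp: transform_def exp_add[symmetric] algebra_simps)
    also have "\<dots> = iexp (t * quicksort_g u) * (\<integral>v. iexp (t * u * fst v) * iexp (t * (1 - u) * snd v) \<partial>(\<mu> \<Otimes>\<^sub>M \<mu>))"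
      by (rule integral_mult_right_zero)
    also have "(\<integral>v. iexp (t * u * fst v) * iexp (t * (1 - u) * snd v) \<partial>(\<mu> \<Otimes>\<^sub>M \<mu>)) =
        (\<integral>y. \<integral>z. iexp (t * u * y) * iexp (t * (1 - u) * z) \<partial>\<mu> \<partial>\<mu>)"
      using YZ.integral_fst'[OF int] by simp
    also have "\<dots> = char \<mu> (t * u) * char \<mu> (t * (1 - u))"
      unfolding char_def by (simp only: integral_mult_right_zero integral_mult_left_zero)
    finally show ?thesis .
  qed
  then show ?thesis
    unfolding char_eq_integral_transform[of t] UYZ.integral_fst'[OF integrable_iexp_transform, symmetric] by simp
qed

text \<open>Fubini in the opposite order: integrate over \<open>u\<close> first with
  \<open>y\<close> and \<open>z\<close> fixed, where the oscillatory bound is uniform, then average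
  over \<open>y\<close> and \<open>z\<close>.\<close>

lemma norm_char_le_inverse_sqrt:
  assumes "t \<noteq> 0"
  shows "norm (char \<mu> t) \<le> 8 / sqrt \<bar>t\<bar>"
proof -
  have int: "integrable (unit_uniform \<Otimes>\<^sub>M (\<mu> \<Otimes>\<^sub>M \<mu>)) (\<lambda>(u, v). iexp (t * transform (u, v)))"
    using integrable_iexp_transform[of t] by (simp add: split_beta')
  have "char \<mu> t = (\<integral>v. \<integral>u. iexp (t * transform (u, v)) \<partial>unit_uniform \<partial>(\<mu> \<Otimes>\<^sub>M \<mu>))"
    unfolding char_eq_integral_transform
    using UYZ.integral_snd[OF int] by (simp add: split_beta')
  also have "norm \<dots> \<le> (\<integral>v. 8 / sqrt \<bar>t\<bar> \<partial>(\<mu> \<Otimes>\<^sub>M \<mu>))"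
    using UYZ.integrable_snd[OF int] quicksort_oscillatory_integral[OF assms]
    by (intro Bochner_Integration.integral_norm_bound_integral) (auto simp: transform_def)
  also have "\<dots> = 8 / sqrt \<bar>t\<bar>" using YZ.P.prob_space by simp
  finally show ?thesis .
qed

lemma norm_char_decay: "\<exists>C. \<forall>t. t \<noteq> 0 \<longrightarrow> norm (char \<mu> t) \<le> C / sqrt \<bar>t\<bar> ^ n"
proof (induction n)
  case 0
  show ?case using cmod_char_le_1 by auto
next
  case (Suc n)
  then obtain C where C: "norm (char \<mu> t) \<le> C / sqrt \<bar>t\<bar> ^ n" if "t \<noteq> 0" for t by blast
  have C0: "0 \<le> C" using order_trans[OF norm_ge_zero C[of 1]] by simp
  have "norm (char \<mu> t) \<le> (C * 2 ^ n * 8 * 4) / sqrt \<bar>t\<bar> ^ Suc n" if t: "t \<noteq> 0" for t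
  proof -
    define K where "K = C * 2 ^ n * 8 / sqrt \<bar>t\<bar> ^ Suc n"
    have K0: "0 \<le> K" using C0 by (simp add: K_def)
    \<comment> \<open>The factor with \<open>a\<close> gets the induction hypothesis, where
      \<open>sqrt a \<ge> 1/2\<close> costs \<open>2 ^ n\<close>; the factor with \<open>b\<close>
      gets the inverse square root bound, whose singularity in \<open>b\<close> is
      integrable.\<close>
    have pt: "norm (char \<mu> (t * a)) * norm (char \<mu> (t * b)) \<le> K * (1 / sqrt b)"
      if a: "1/2 \<le> a" and b: "0 < b" for a b
    proof -
      have "1/2 \<le> sqrt a" using a by (intro real_le_rsqrt) (simp add: power2_eq_square)
      then have "sqrt \<bar>t\<bar> * (1/2) \<le> sqrt \<bar>t * a\<bar>"
        using mult_left_mono[of "1/2" "sqrt a" "sqrt \<bar>t\<bar>"] a by (simp add: abs_mult real_sqrt_mult)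
      then have le: "(sqrt \<bar>t\<bar> * (1/2)) ^ n \<le> sqrt \<bar>t * a\<bar> ^ n"
        by (intro power_mono) auto
      have "norm (char \<mu> (t * a)) \<le> C / sqrt \<bar>t * a\<bar> ^ n"
        using t a by (intro C) auto
      also have "\<dots> \<le> C / (sqrt \<bar>t\<bar> * (1/2)) ^ n"
        using le t a C0 by (intro divide_left_mono mult_pos_pos zero_less_power) auto
      also have "\<dots> = C * 2 ^ n / sqrt \<bar>t\<bar> ^ n"
        by (simp add: power_divide)
      finally have 1: "norm (char \<mu> (t * a)) \<le> C * 2 ^ n / sqrt \<bar>t\<bar> ^ n" .
      have "norm (char \<mu> (t * b)) \<le> 8 / sqrt \<bar>t * b\<bar>"
        using t b by (intro norm_char_le_inverse_sqrt) auto
      also have "\<dots> = 8 / (sqrt \<bar>t\<bar> * sqrt b)"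
        using b by (simp add: abs_mult real_sqrt_mult)
      finally have "norm (char \<mu> (t * a)) * norm (char \<mu> (t * b)) \<le> (C * 2 ^ n / sqrt \<bar>t\<bar> ^ n) * (8 / (sqrt \<bar>t\<bar> * sqrt b))"
        using 1 C0 by (intro mult_mono) auto
      then show ?thesis by (simp add: K_def mult_ac)
    qed
    \<comment> \<open>Whichever of \<open>u\<close> and \<open>1 - u\<close> is at least 1/2 plays
      the role of \<open>a\<close>. Adding both singular terms gives one bound valid in both
      cases.\<close>
    have bd: "norm (char \<mu> (t * u)) * norm (char \<mu> (t * (1 - u))) \<le> K * (1 / sqrt u + 1 / sqrt (1 - u))"
      if u: "0 < u" "u < 1" for u
    proof (cases "1/2 \<le> u")
      case True
      have "0 \<le> K * (1 / sqrt u)" using K0 u by simp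
      with pt[of u "1 - u"] True u show ?thesis by (simp add: distrib_left)
    next
      case False
      have "0 \<le> K * (1 / sqrt (1 - u))" using K0 u by simp
      with pt[of "1 - u" u] False u show ?thesis by (simp add: distrib_left mult.commute)
    qed
    have "ennreal (norm (char \<mu> t)) \<le> (\<integral>\<^sup>+u. norm (iexp (t * quicksort_g u) * (char \<mu> (t * u) * char \<mu> (t * (1 - u)))) \<partial>unit_uniform)"
      unfolding char_fixed_point[of t]
      by (intro integral_norm_bound_ennreal U.integrable_const_bound[where B = 1])
        (auto simp: norm_mult intro!: mult_le_one cmod_char_le_1)
    also have "\<dots> \<le> (\<integral>\<^sup>+u. ennreal (K * (1 / sqrt u + 1 / sqrt (1 - u))) \<partial>unit_uniform)"
      by (intro nn_integral_mono_AE eventually_mono[OF AE_unit_uniform] ennreal_leI) (simp add: norm_mult bd)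
    also have "\<dots> \<le> ennreal (K * 4)"
      using K0 by (intro nn_integral_unit_uniform_le has_integral_mult_right has_integral_inverse_sqrt_sum) auto
    finally have "norm (char \<mu> t) \<le> K * 4" using K0 by (simp add: ennreal_le_iff)
    then show ?thesis by (simp add: K_def)
  qed
  then show ?case by blast
qed

section \<open>Derivatives of the characteristic function and their decay\<close>

definition char_deriv :: "nat \<Rightarrow> real \<Rightarrow> complex" where
  "char_deriv k t = (\<integral>x. (\<i> * x) ^ k * iexp (t * x) \<partial>\<mu>)"

lemma char_deriv_difference:
  "norm (char_deriv k (t + s) - char_deriv k t - s * char_deriv (Suc k) t) \<le> s\<^sup>2 * ((\<integral>x. \<bar>x\<bar> ^ (k + 2) \<partial>\<mu>) / 2)"
  using moment_transform_difference[OF integrable_abs_moment, of k t s] by (simp add: char_deriv_def)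

lemma has_vector_derivative_char_deriv:
  "(char_deriv k has_vector_derivative char_deriv (Suc k) t) (at t)"
  using char_deriv_difference by (rule has_vector_derivative_quadratic_remainder)

lemma nth_deriv_char: "nth_deriv k (char \<mu>) = char_deriv k"
proof (induction k)
  case 0
  show ?case by (auto simp: nth_deriv_def char_deriv_def char_def)
next
  case (Suc k)
  have "nth_deriv (Suc k) (char \<mu>) = (\<lambda>t. vector_derivative (nth_deriv k (char \<mu>)) (at t))"
    by (simp add: nth_deriv_def)
  with Suc show ?case by (simp add: vector_derivative_at[OF has_vector_derivative_char_deriv])
qed

lemma norm_char_deriv_le: "norm (char_deriv k t) \<le> (\<integral>x. \<bar>x\<bar> ^ k \<partial>\<mu>)"
proof -
  have "norm (char_deriv k t) \<le> (\<integral>x. norm ((\<i> * complex_of_real x) ^ k * iexp (t * x)) \<partial>\<mu>)"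
    unfolding char_deriv_def by (rule integral_norm_bound)
  then show ?thesis by (simp add: norm_mult norm_power)
qed

lemma rapidly_decreasing_char_deriv: "rapidly_decreasing (char_deriv k)"
proof (induction k)
  case 0
  have "\<exists>C. \<forall>t. 1 \<le> \<bar>t\<bar> \<longrightarrow> norm (char_deriv 0 t) \<le> C / \<bar>t\<bar> ^ m" for m
  proof -
    obtain C where "norm (char \<mu> t) \<le> C / sqrt \<bar>t\<bar> ^ (2 * m)" if "t \<noteq> 0" for t
      using norm_char_decay by blast
    then show ?thesis
      by (intro exI[of _ C]) (auto simp: char_deriv_def char_def power_mult)
  qed
  then show ?case unfolding rapidly_decreasing_def by blast
next
  case (Suc k)
  then show ?case by (rule rapidly_decreasing_derivative[OF _ char_deriv_difference])
qed

text \<open>Boundedness handles absolute values below 1, where the negative power is at least 1;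
  rapid decay with \<open>p\<close> rounded up handles the rest. The conditional is present because
  \<open>0 powr 0\<close> evaluates to 0, whereas the bound at \<open>t = 0\<close> for
  \<open>p = 0\<close> calls for the value 1.\<close>

lemma char_deriv_decay:
  assumes "0 \<le> p"
  shows "\<exists>c. \<forall>t. (t \<noteq> 0 \<or> p = 0) \<longrightarrow> norm (char_deriv k t) \<le> c * (if t = 0 then 1 else \<bar>t\<bar> powr (- p))"
proof -
  define m where "m = nat \<lceil>p\<rceil>"
  define B where "B = (\<integral>x. \<bar>x\<bar> ^ k \<partial>\<mu>)"
  obtain C where C: "norm (char_deriv k t) \<le> C / \<bar>t\<bar> ^ m" if "1 \<le> \<bar>t\<bar>" for t
    using rapidly_decreasing_char_deriv unfolding rapidly_decreasing_def by blast
  have C0: "0 \<le> C" using order_trans[OF norm_ge_zero C[of 1]] by simp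
  have B: "norm (char_deriv k t) \<le> B" for t unfolding B_def by (rule norm_char_deriv_le)
  have B0: "0 \<le> B" using order_trans[OF norm_ge_zero B[of 0]] .
  have "norm (char_deriv k t) \<le> (B + C) * (if t = 0 then 1 else \<bar>t\<bar> powr (- p))" for t
  proof -
    consider "t = 0" | "t \<noteq> 0" "\<bar>t\<bar> < 1" | "1 \<le> \<bar>t\<bar>" by linarith
    then show ?thesis
    proof cases
      case 1
      then show ?thesis using B[of t] C0 by simp
    next
      case 2
      have "1 \<le> \<bar>t\<bar> powr (- p)"
        using 2 assms powr_mono2'[of "- p" "\<bar>t\<bar>" 1] by simp
      then have "(B + C) * 1 \<le> (B + C) * \<bar>t\<bar> powr (- p)"
        using B0 C0 by (intro mult_left_mono) auto
      then show ?thesis using B[of t] C0 2 by simp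
    next
      case 3
      have "p \<le> real m" unfolding m_def using assms by linarith
      then have "\<bar>t\<bar> powr (- real m) \<le> \<bar>t\<bar> powr (- p)"
        using 3 by (intro powr_mono) auto
      then have "C / \<bar>t\<bar> ^ m \<le> C * \<bar>t\<bar> powr (- p)"
        using 3 C0 by (simp add: powr_minus powr_realpow divide_inverse mult_left_mono)
      also have "\<dots> \<le> (B + C) * \<bar>t\<bar> powr (- p)"
        using B0 by (intro mult_right_mono) auto
      finally show ?thesis using C[OF 3] 3 by auto
    qed
  qed
  then show ?thesis by blast
qed

end

theorem theorem2p9:
  fixes \<mu> :: "real measure"
  assumes "quicksort_limit_law \<mu>"
  shows "(\<forall>k t. (nth_deriv k (char \<mu>) has_vector_derivative nth_deriv (Suc k) (char \<mu>) t) (at t))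
    \<and> (\<forall>(p::real) (k::nat). p \<ge> 0 \<longrightarrow> (\<exists>c::real. \<forall>t::real. (t \<noteq> 0 \<or> p = 0) \<longrightarrow>
          norm (nth_deriv k (char \<mu>) t) \<le> c * (if t = 0 then 1 else \<bar>t\<bar> powr (- p))))"
proof -
  interpret quicksort_limit \<mu> by unfold_locales (rule assms)
  show ?thesis
    using has_vector_derivative_char_deriv char_deriv_decay by (simp only: nth_deriv_char) blast
qed

end
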